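(* Let $n\geq 4$ and let $\gamma: WT_n\to\mathrm{GL}_{n+1}(\mathbb{C})$ be a homogeneous $3$-local representation of the welded twin group $WT_n$. Then $\gamma$ is equivalent to one of the five representations $\gamma_j$, $1\leq j\leq 5$, defined by $\gamma_j(s_i)=\mathrm{diag}(I_{i-1},M_j,I_{n-i-1})$ and $\gamma_j(\rho_i)=\mathrm{diag}(I_{i-1},N_j,I_{n-i-1})$ for all $1\leq i\leq n-1$, where: (1) $M_1=\begin{pmatrix}1&0&0\\0&0&\frac1h\\0&h&0\end{pmatrix}$, $N_1=\begin{pmatrix}1&0&0\\0&0&p\\0&\frac1p&0\end{pmatrix}$, $h,p\in\mathbb{C}^*$; (2) $M_2=\begin{pmatrix}0&\frac1d&0\\d&0&0\\0&0&1\end{pmatrix}$, $N_2=\begin{pmatrix}0&k&0\\\frac1k&0&0\\0&0&1\end{pmatrix}$, $d,k\in\mathbb{C}^*$; (3) $M_3=N_3=\begin{pmatrix}1&0&0\\\frac1p&-1&p\\0&0&1\end{pmatrix}$, $p\in\mathbb{C}^*$; (4) $M_4=N_4=\begin{pmatrix}1&k&0\\0&-1&0\\0&\frac1k&1\end{pmatrix}$, $k\in\mathbb{C}^*$; (5) $M_5=N_5=I_3$.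
   Context: The virtual twin group $VT_n$ ($n\geq 2$) has generators $s_1,\dots,s_{n-1},\rho_1,\dots,\rho_{n-1}$ and defining relations: $s_i^2=1$ ($1\le i\le n-1$); $s_is_j=s_js_i$ ($|i-j|\ge2$); $\rho_i\rho_{i+1}\rho_i=\rho_{i+1}\rho_i\rho_{i+1}$ ($1\le i\le n-2$); $\rho_i\rho_j=\rho_j\rho_i$ ($|i-j|\ge2$); $\rho_i^2=1$; $s_i\rho_j=\rho_js_i$ ($|i-j|\ge2$); $\rho_i\rho_{i+1}s_i=s_{i+1}\rho_i\rho_{i+1}$ ($1\le i\le n-2$). The welded twin group $WT_n$ is the quotient of $VT_n$ by the additional relations $\rho_is_{i+1}s_i=s_{i+1}s_i\rho_{i+1}$ ($1\le i\le n-2$). A representation $\gamma:WT_n\to\mathrm{GL}_{n+1}(\mathbb{C})$ is homogeneous $3$-local if there are fixed $M,N\in\mathrm{GL}_3(\mathbb{C})$ with $\gamma(s_i)=\mathrm{diag}(I_{i-1},M,I_{n-i-1})$ and $\gamma(\rho_i)=\mathrm{diag}(I_{i-1},N,I_{n-i-1})$ for all $i$, with $\mathrm{diag}$ block-diagonal and $I_r$ the $r\times r$ identity. $\mathbb{C}^*=\mathbb{C}\setminus\{0\}$. Equivalent means conjugate by an invertible matrix. *)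

theory Defs
  imports "Jordan_Normal_Form.Matrix" "Jordan_Normal_Form.Determinant"
begin

text \<open>Block-diagonal local matrix diag(I_{i-1}, A, I_{n-i-1}) of size (n+1)x(n+1),
  for a 3x3 matrix A and generator index 1 <= i <= n-1 (matrix indices are 0-based,
  so the block occupies rows/columns i-1, i, i+1).\<close>
definition loc_mat :: "nat \<Rightarrow> nat \<Rightarrow> complex mat \<Rightarrow> complex mat" where
  "loc_mat n i A = mat (n+1) (n+1) (\<lambda>(r,c).
     if i - 1 \<le> r \<and> r \<le> i + 1 \<and> i - 1 \<le> c \<and> c \<le> i + 1
     then A $$ (r - (i - 1), c - (i - 1))
     else if r = c then 1 else 0)"

text \<open>The assignment s_i |-> S i, rho_i |-> R i (1 <= i <= n-1) of invertible
  (n+1)x(n+1) complex matrices satisfies the defining relations of VT_n.\<close>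
definition VT_rep :: "nat \<Rightarrow> (nat \<Rightarrow> complex mat) \<Rightarrow> (nat \<Rightarrow> complex mat) \<Rightarrow> bool" where
  "VT_rep n S R \<longleftrightarrow>
     (\<forall>i\<in>{1..n-1}. S i \<in> carrier_mat (n+1) (n+1) \<and> R i \<in> carrier_mat (n+1) (n+1)
        \<and> invertible_mat (S i) \<and> invertible_mat (R i)) \<and>
     (\<forall>i\<in>{1..n-1}. S i * S i = 1\<^sub>m (n+1)) \<and>
     (\<forall>i\<in>{1..n-1}. \<forall>j\<in>{1..n-1}. (i + 2 \<le> j \<or> j + 2 \<le> i) \<longrightarrow> S i * S j = S j * S i) \<and>
     (\<forall>i\<in>{1..n-2}. R i * R (i+1) * R i = R (i+1) * R i * R (i+1)) \<and>
     (\<forall>i\<in>{1..n-1}. \<forall>j\<in>{1..n-1}. (i + 2 \<le> j \<or> j + 2 \<le> i) \<longrightarrow> R i * R j = R j * R i) \<and>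
     (\<forall>i\<in>{1..n-1}. R i * R i = 1\<^sub>m (n+1)) \<and>
     (\<forall>i\<in>{1..n-1}. \<forall>j\<in>{1..n-1}. (i + 2 \<le> j \<or> j + 2 \<le> i) \<longrightarrow> S i * R j = R j * S i) \<and>
     (\<forall>i\<in>{1..n-2}. R i * R (i+1) * S i = S (i+1) * R i * R (i+1))"

definition WT_rep :: "nat \<Rightarrow> (nat \<Rightarrow> complex mat) \<Rightarrow> (nat \<Rightarrow> complex mat) \<Rightarrow> bool" where
  "WT_rep n S R \<longleftrightarrow> VT_rep n S R \<and>
     (\<forall>i\<in>{1..n-2}. R i * S (i+1) * S i = S (i+1) * S i * R (i+1))"

definition hom_3local_WT_rep :: "nat \<Rightarrow> complex mat \<Rightarrow> complex mat \<Rightarrow> bool" where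
  "hom_3local_WT_rep n M N \<longleftrightarrow> M \<in> carrier_mat 3 3 \<and> N \<in> carrier_mat 3 3 \<and>
     invertible_mat M \<and> invertible_mat N \<and>
     WT_rep n (\<lambda>i. loc_mat n i M) (\<lambda>i. loc_mat n i N)"

definition equiv_rep :: "nat \<Rightarrow> (nat \<Rightarrow> complex mat) \<Rightarrow> (nat \<Rightarrow> complex mat)
    \<Rightarrow> (nat \<Rightarrow> complex mat) \<Rightarrow> (nat \<Rightarrow> complex mat) \<Rightarrow> bool" where
  "equiv_rep n S R S' R' \<longleftrightarrow> (\<exists>P\<in>carrier_mat (n+1) (n+1). invertible_mat P \<and>
     (\<forall>i\<in>{1..n-1}. P * S i = S' i * P \<and> P * R i = R' i * P))"

definition M1 :: "complex \<Rightarrow> complex mat" where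
  "M1 h = mat_of_rows_list 3 [[1,0,0],[0,0,1/h],[0,h,0]]"
definition N1 :: "complex \<Rightarrow> complex mat" where
  "N1 p = mat_of_rows_list 3 [[1,0,0],[0,0,p],[0,1/p,0]]"
definition M2 :: "complex \<Rightarrow> complex mat" where
  "M2 d = mat_of_rows_list 3 [[0,1/d,0],[d,0,0],[0,0,1]]"
definition N2 :: "complex \<Rightarrow> complex mat" where
  "N2 k = mat_of_rows_list 3 [[0,k,0],[1/k,0,0],[0,0,1]]"
definition M3 :: "complex \<Rightarrow> complex mat" where
  "M3 p = mat_of_rows_list 3 [[1,0,0],[1/p,-1,p],[0,0,1]]"
definition M4 :: "complex \<Rightarrow> complex mat" where
  "M4 k = mat_of_rows_list 3 [[1,k,0],[0,-1,0],[0,1/k,1]]"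

definition five_families :: "(complex mat \<times> complex mat) set" where
  "five_families =
     {(M1 h, N1 p) | h p. h \<noteq> 0 \<and> p \<noteq> 0} \<union>
     {(M2 d, N2 k) | d k. d \<noteq> 0 \<and> k \<noteq> 0} \<union>
     {(M3 p, M3 p) | p. p \<noteq> 0} \<union>
     {(M4 k, M4 k) | k. k \<noteq> 0} \<union>
     {(1\<^sub>m 3, 1\<^sub>m 3)}"

end

theory Submission
  imports Defs
begin

text \<open>
  No conjugation is needed: the pair \<open>(M, N)\<close> itself lies in one of the five families. The blocks of
  the generators with indices 1 and 3 overlap in a single coordinate, so their commutation kills the
  corner entries of \<open>M\<close> and \<open>N\<close>. For such a tridiagonal \<open>N\<close> the corner entries of the braid relation
  together with \<open>N\<^sup>2 = I\<close> force \<open>N\<^sub>0\<^sub>0, N\<^sub>2\<^sub>2 \<in> {0, 1}\<close>, which leaves five shapes. In each of them the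
  commutation of \<open>M\<close> with \<open>N\<close> fixes the shape of \<open>M\<close>, and the mixed and welded relations fix
  the remaining entries.
\<close>

section \<open>Entries of products of local matrices\<close>

lemma loc_mat_carrier [simp]: "loc_mat n i A \<in> carrier_mat (Suc n) (Suc n)"
  by (simp add: loc_mat_def)

lemma loc_mat_mult_carrier [simp]:
  "Q \<in> carrier_mat (Suc n) (Suc n) \<Longrightarrow> loc_mat n i A * Q \<in> carrier_mat (Suc n) (Suc n)"
  by (rule mult_carrier_mat[OF loc_mat_carrier])

text \<open>Writing the generator index as \<open>Suc j\<close> turns the truncated subtraction
  \<open>i - 1\<close> into \<open>j\<close>, the first row of the block.\<close>

lemma loc_mat_index:
  assumes "r \<le> n" "c \<le> n"
  shows "loc_mat n (Suc j) A $$ (r,c) =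
    (if j \<le> r \<and> r \<le> j + 2 \<and> j \<le> c \<and> c \<le> j + 2
     then A $$ (r - j, c - j)
     else if r = c then 1 else 0)"
  using assms by (simp add: loc_mat_def)

text \<open>Left multiplication by a local matrix mixes only the rows \<open>j\<close>,
  \<open>j + 1\<close>, \<open>j + 2\<close>. Since \<open>Q\<close> is arbitrary, repeated
  rewriting evaluates any right-nested product.\<close>

lemma loc_mat_mult_index:
  assumes "j + 2 \<le> n" "Q \<in> carrier_mat (Suc n) (Suc n)" "r \<le> n" "c \<le> n"
  shows "(loc_mat n (Suc j) A * Q) $$ (r,c) =
    (if j \<le> r \<and> r \<le> j + 2
     then A $$ (r - j, 0) * Q $$ (j, c) + A $$ (r - j, 1) * Q $$ (j + 1, c)
        + A $$ (r - j, 2) * Q $$ (j + 2, c)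
     else Q $$ (r,c))"
proof -
  have eq: "(loc_mat n (Suc j) A * Q) $$ (r,c)
      = (\<Sum>k<Suc n. loc_mat n (Suc j) A $$ (r,k) * Q $$ (k,c))"
    using assms carrier_matD[OF loc_mat_carrier[of n "Suc j" A]]
    by (simp add: scalar_prod_def lessThan_atLeast0 del: sum.lessThan_Suc)
  show ?thesis
  proof (cases "j \<le> r \<and> r \<le> j + 2")
    case True
    have "(\<Sum>k<Suc n. loc_mat n (Suc j) A $$ (r,k) * Q $$ (k,c))
        = (\<Sum>k\<in>{j, j + 1, j + 2}. loc_mat n (Suc j) A $$ (r,k) * Q $$ (k,c))"
      using assms True by (intro sum.mono_neutral_right) (auto simp: loc_mat_index)
    with True eq assms show ?thesis by (simp add: loc_mat_index)
  next
    case False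
    have "(\<Sum>k<Suc n. loc_mat n (Suc j) A $$ (r,k) * Q $$ (k,c))
        = (\<Sum>k\<in>{r}. loc_mat n (Suc j) A $$ (r,k) * Q $$ (k,c))"
      using assms False by (intro sum.mono_neutral_right) (auto simp: loc_mat_index)
    also have "\<dots> = Q $$ (r,c)"
      using assms False by (auto simp: loc_mat_index)
    finally show ?thesis using False eq by auto
  qed
qed

text \<open>The two blocks occupy the coordinates 0..2 and 2..4, so only the last row and column of
  \<open>A\<close> meet the first row and column of \<open>B\<close>. For \<open>A = B\<close> the
  first two equations are squares and kill the corners; for distinct blocks the others transfer
  information from one to the other.\<close>

lemma loc_mat_commute_entries:
  assumes n: "n \<ge> 4" and comm: "loc_mat n 1 A * loc_mat n 3 B = loc_mat n 3 B * loc_mat n 1 A"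
  shows "A $$ (0,2) * B $$ (0,2) = 0" "B $$ (2,0) * A $$ (2,0) = 0"
    "A $$ (1,2) * B $$ (0,0) = A $$ (1,2)" "A $$ (1,2) * B $$ (0,1) = 0"
    "A $$ (2,2) * B $$ (0,1) = B $$ (0,1)" "B $$ (0,0) * A $$ (2,1) = A $$ (2,1)"
    "B $$ (1,0) * A $$ (2,1) = 0" "B $$ (1,0) * A $$ (2,2) = B $$ (1,0)"
proof -
  have ent: "(loc_mat n (Suc 0) A * loc_mat n (Suc 2) B) $$ (r,c)
      = (loc_mat n (Suc 2) B * loc_mat n (Suc 0) A) $$ (r,c)" for r c
    using comm by simp
  show "A $$ (0,2) * B $$ (0,2) = 0" "B $$ (2,0) * A $$ (2,0) = 0"
    "A $$ (1,2) * B $$ (0,0) = A $$ (1,2)" "A $$ (1,2) * B $$ (0,1) = 0"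
    "A $$ (2,2) * B $$ (0,1) = B $$ (0,1)" "B $$ (0,0) * A $$ (2,1) = A $$ (2,1)"
    "B $$ (1,0) * A $$ (2,1) = 0" "B $$ (1,0) * A $$ (2,2) = B $$ (1,0)"
    using n ent[of 0 4] ent[of 4 0] ent[of 1 2] ent[of 1 3] ent[of 2 3] ent[of 2 1] ent[of 3 1]
      ent[of 3 2]
    by (simp_all add: loc_mat_mult_index loc_mat_index numeral_eq_Suc del: index_mult_mat)
qed

definition tridiagonal3 :: "complex mat \<Rightarrow> bool" where
  "tridiagonal3 A \<longleftrightarrow> A $$ (0,2) = 0 \<and> A $$ (2,0) = 0"

text \<open>Zero corners in \<open>A\<close> leave a single product in each corner of the square;
  these last two equations limit which off-diagonal entries can coexist.\<close>

lemma loc_mat_involution_entries: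
  assumes n: "n \<ge> 2" and inv: "loc_mat n 1 A * loc_mat n 1 A = 1\<^sub>m (n+1)"
    and tri: "tridiagonal3 A"
  shows "A $$ (0,0) * A $$ (0,0) + A $$ (0,1) * A $$ (1,0) = 1"
    "A $$ (0,1) * (A $$ (0,0) + A $$ (1,1)) = 0" "A $$ (1,0) * (A $$ (0,0) + A $$ (1,1)) = 0"
    "A $$ (1,0) * A $$ (0,1) + A $$ (1,1) * A $$ (1,1) + A $$ (1,2) * A $$ (2,1) = 1"
    "A $$ (1,2) * (A $$ (1,1) + A $$ (2,2)) = 0" "A $$ (2,1) * (A $$ (1,1) + A $$ (2,2)) = 0"
    "A $$ (2,1) * A $$ (1,2) + A $$ (2,2) * A $$ (2,2) = 1"
    "A $$ (0,1) * A $$ (1,2) = 0" "A $$ (2,1) * A $$ (1,0) = 0"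
proof -
  have ent: "(loc_mat n (Suc 0) A * loc_mat n (Suc 0) A) $$ (r,c) = 1\<^sub>m (Suc n) $$ (r,c)" for r c
    using inv by simp
  show "A $$ (0,0) * A $$ (0,0) + A $$ (0,1) * A $$ (1,0) = 1"
    "A $$ (0,1) * (A $$ (0,0) + A $$ (1,1)) = 0" "A $$ (1,0) * (A $$ (0,0) + A $$ (1,1)) = 0"
    "A $$ (1,0) * A $$ (0,1) + A $$ (1,1) * A $$ (1,1) + A $$ (1,2) * A $$ (2,1) = 1"
    "A $$ (1,2) * (A $$ (1,1) + A $$ (2,2)) = 0" "A $$ (2,1) * (A $$ (1,1) + A $$ (2,2)) = 0"
    "A $$ (2,1) * A $$ (1,2) + A $$ (2,2) * A $$ (2,2) = 1"
    "A $$ (0,1) * A $$ (1,2) = 0" "A $$ (2,1) * A $$ (1,0) = 0"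
    using n tri ent[of 0 0] ent[of 0 1] ent[of 1 0] ent[of 1 1] ent[of 1 2] ent[of 2 1] ent[of 2 2]
      ent[of 0 2] ent[of 2 0]
    by (simp_all add: tridiagonal3_def loc_mat_mult_index loc_mat_index algebra_simps numeral_eq_Suc
        del: index_mult_mat mult_eq_0_iff)
qed

text \<open>The entries at (0,0), (0,1), (1,0), (1,1), (1,2), (2,1), (2,2), (2,3), (3,3).\<close>
lemma loc_mat_braid_entries:
  assumes n: "n \<ge> 3"
    and rel: "loc_mat n 1 A * loc_mat n 2 B * loc_mat n 1 C
      = loc_mat n 2 D * loc_mat n 1 E * loc_mat n 2 F"
    and tri: "tridiagonal3 A" "tridiagonal3 B" "tridiagonal3 C"
      "tridiagonal3 D" "tridiagonal3 E" "tridiagonal3 F"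
  shows
    "A $$ (0,0) * C $$ (0,0) + A $$ (0,1) * B $$ (0,0) * C $$ (1,0)
      = E $$ (0,0)"
    "A $$ (0,0) * C $$ (0,1) + A $$ (0,1) * B $$ (0,0) * C $$ (1,1)
        + A $$ (0,1) * B $$ (0,1) * C $$ (2,1)
      = E $$ (0,1) * F $$ (0,0)"
    "A $$ (1,0) * C $$ (0,0) + A $$ (1,1) * B $$ (0,0) * C $$ (1,0)
        + A $$ (1,2) * B $$ (1,0) * C $$ (1,0)
      = D $$ (0,0) * E $$ (1,0)"
    "A $$ (1,0) * C $$ (0,1) + A $$ (1,1) * B $$ (0,0) * C $$ (1,1)
        + A $$ (1,1) * B $$ (0,1) * C $$ (2,1) + A $$ (1,2) * B $$ (1,0) * C $$ (1,1)
        + A $$ (1,2) * B $$ (1,1) * C $$ (2,1)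
      = D $$ (0,0) * E $$ (1,1) * F $$ (0,0) + D $$ (0,0) * E $$ (1,2) * F $$ (1,0)
        + D $$ (0,1) * E $$ (2,1) * F $$ (0,0) + D $$ (0,1) * E $$ (2,2) * F $$ (1,0)"
    "A $$ (1,1) * B $$ (0,0) * C $$ (1,2) + A $$ (1,1) * B $$ (0,1) * C $$ (2,2)
        + A $$ (1,2) * B $$ (1,0) * C $$ (1,2) + A $$ (1,2) * B $$ (1,1) * C $$ (2,2)
      = D $$ (0,0) * E $$ (1,1) * F $$ (0,1) + D $$ (0,0) * E $$ (1,2) * F $$ (1,1)
        + D $$ (0,1) * E $$ (2,1) * F $$ (0,1) + D $$ (0,1) * E $$ (2,2) * F $$ (1,1)"
    "A $$ (2,1) * B $$ (0,0) * C $$ (1,1) + A $$ (2,1) * B $$ (0,1) * C $$ (2,1)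
        + A $$ (2,2) * B $$ (1,0) * C $$ (1,1) + A $$ (2,2) * B $$ (1,1) * C $$ (2,1)
      = D $$ (1,0) * E $$ (1,1) * F $$ (0,0) + D $$ (1,0) * E $$ (1,2) * F $$ (1,0)
        + D $$ (1,1) * E $$ (2,1) * F $$ (0,0) + D $$ (1,1) * E $$ (2,2) * F $$ (1,0)"
    "A $$ (2,1) * B $$ (0,0) * C $$ (1,2) + A $$ (2,1) * B $$ (0,1) * C $$ (2,2)
        + A $$ (2,2) * B $$ (1,0) * C $$ (1,2) + A $$ (2,2) * B $$ (1,1) * C $$ (2,2)
      = D $$ (1,0) * E $$ (1,1) * F $$ (0,1) + D $$ (1,0) * E $$ (1,2) * F $$ (1,1)
        + D $$ (1,1) * E $$ (2,1) * F $$ (0,1) + D $$ (1,1) * E $$ (2,2) * F $$ (1,1)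
        + D $$ (1,2) * F $$ (2,1)"
    "A $$ (2,2) * B $$ (1,2)
      = D $$ (1,0) * E $$ (1,2) * F $$ (1,2) + D $$ (1,1) * E $$ (2,2) * F $$ (1,2)
        + D $$ (1,2) * F $$ (2,2)"
    "B $$ (2,2)
      = D $$ (2,1) * E $$ (2,2) * F $$ (1,2) + D $$ (2,2) * F $$ (2,2)"
proof -
  \<comment> \<open>Nesting to the right offers \<open>loc_mat_mult_index\<close> one local factor
    at a time.\<close>
  have "loc_mat n (Suc 0) A * (loc_mat n (Suc 1) B * loc_mat n (Suc 0) C)
      = loc_mat n (Suc 1) D * (loc_mat n (Suc 0) E * loc_mat n (Suc 1) F)"
    using rel by (simp add: numeral_2_eq_2
        assoc_mult_mat[OF loc_mat_carrier loc_mat_carrier loc_mat_carrier])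
  then have ent: "(loc_mat n (Suc 0) A * (loc_mat n (Suc 1) B * loc_mat n (Suc 0) C)) $$ (r,c)
      = (loc_mat n (Suc 1) D * (loc_mat n (Suc 0) E * loc_mat n (Suc 1) F)) $$ (r,c)" for r c
    by (rule arg_cong)
  show
    "A $$ (0,0) * C $$ (0,0) + A $$ (0,1) * B $$ (0,0) * C $$ (1,0)
      = E $$ (0,0)"
    "A $$ (0,0) * C $$ (0,1) + A $$ (0,1) * B $$ (0,0) * C $$ (1,1)
        + A $$ (0,1) * B $$ (0,1) * C $$ (2,1)
      = E $$ (0,1) * F $$ (0,0)"
    "A $$ (1,0) * C $$ (0,0) + A $$ (1,1) * B $$ (0,0) * C $$ (1,0)
        + A $$ (1,2) * B $$ (1,0) * C $$ (1,0)
      = D $$ (0,0) * E $$ (1,0)"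
    "A $$ (1,0) * C $$ (0,1) + A $$ (1,1) * B $$ (0,0) * C $$ (1,1)
        + A $$ (1,1) * B $$ (0,1) * C $$ (2,1) + A $$ (1,2) * B $$ (1,0) * C $$ (1,1)
        + A $$ (1,2) * B $$ (1,1) * C $$ (2,1)
      = D $$ (0,0) * E $$ (1,1) * F $$ (0,0) + D $$ (0,0) * E $$ (1,2) * F $$ (1,0)
        + D $$ (0,1) * E $$ (2,1) * F $$ (0,0) + D $$ (0,1) * E $$ (2,2) * F $$ (1,0)"
    "A $$ (1,1) * B $$ (0,0) * C $$ (1,2) + A $$ (1,1) * B $$ (0,1) * C $$ (2,2)
        + A $$ (1,2) * B $$ (1,0) * C $$ (1,2) + A $$ (1,2) * B $$ (1,1) * C $$ (2,2)
      = D $$ (0,0) * E $$ (1,1) * F $$ (0,1) + D $$ (0,0) * E $$ (1,2) * F $$ (1,1)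
        + D $$ (0,1) * E $$ (2,1) * F $$ (0,1) + D $$ (0,1) * E $$ (2,2) * F $$ (1,1)"
    "A $$ (2,1) * B $$ (0,0) * C $$ (1,1) + A $$ (2,1) * B $$ (0,1) * C $$ (2,1)
        + A $$ (2,2) * B $$ (1,0) * C $$ (1,1) + A $$ (2,2) * B $$ (1,1) * C $$ (2,1)
      = D $$ (1,0) * E $$ (1,1) * F $$ (0,0) + D $$ (1,0) * E $$ (1,2) * F $$ (1,0)
        + D $$ (1,1) * E $$ (2,1) * F $$ (0,0) + D $$ (1,1) * E $$ (2,2) * F $$ (1,0)"
    "A $$ (2,1) * B $$ (0,0) * C $$ (1,2) + A $$ (2,1) * B $$ (0,1) * C $$ (2,2)
        + A $$ (2,2) * B $$ (1,0) * C $$ (1,2) + A $$ (2,2) * B $$ (1,1) * C $$ (2,2)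
      = D $$ (1,0) * E $$ (1,1) * F $$ (0,1) + D $$ (1,0) * E $$ (1,2) * F $$ (1,1)
        + D $$ (1,1) * E $$ (2,1) * F $$ (0,1) + D $$ (1,1) * E $$ (2,2) * F $$ (1,1)
        + D $$ (1,2) * F $$ (2,1)"
    "A $$ (2,2) * B $$ (1,2)
      = D $$ (1,0) * E $$ (1,2) * F $$ (1,2) + D $$ (1,1) * E $$ (2,2) * F $$ (1,2)
        + D $$ (1,2) * F $$ (2,2)"
    "B $$ (2,2)
      = D $$ (2,1) * E $$ (2,2) * F $$ (1,2) + D $$ (2,2) * F $$ (2,2)"
    using n tri ent[of 0 0]
    ent[of 0 1]
    ent[of 1 0]
    ent[of 1 1]
    ent[of 1 2]
    ent[of 2 1]
    ent[of 2 2]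
    ent[of 2 3]
    ent[of 3 3]
    by (simp_all add: tridiagonal3_def loc_mat_mult_index loc_mat_index algebra_simps numeral_eq_Suc
        del: index_mult_mat)
qed

section \<open>Scalar equations for 3x3 blocks\<close>

lemma mat3_eqI:
  assumes "A \<in> carrier_mat 3 3" "B \<in> carrier_mat 3 3"
    "A $$ (0,0) = B $$ (0,0)" "A $$ (0,1) = B $$ (0,1)" "A $$ (0,2) = B $$ (0,2)"
    "A $$ (1,0) = B $$ (1,0)" "A $$ (1,1) = B $$ (1,1)" "A $$ (1,2) = B $$ (1,2)"
    "A $$ (2,0) = B $$ (2,0)" "A $$ (2,1) = B $$ (2,1)" "A $$ (2,2) = B $$ (2,2)"
  shows "A = B"
proof (rule eq_matI)
  fix i j assume "i < dim_row B" "j < dim_col B"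
  with assms(2) have "i = 0 \<or> i = 1 \<or> i = 2" "j = 0 \<or> j = 1 \<or> j = 2" by auto
  with assms show "A $$ (i,j) = B $$ (i,j)" by metis
qed (use assms in auto)

text \<open>
  Here \<open>a, \<dots>, g\<close> are the entries of a tridiagonal 3x3 matrix read row by row;
  the braid hypotheses are the (0,0), (3,3) and (1,1) entries of the braid relation.
\<close>
lemma involution_braid_cases:
  fixes a b c d e f g :: complex
  assumes inv: "a * a + b * c = 1" "b * (a + d) = 0" "c * (a + d) = 0"
      "c * b + d * d + e * f = 1" "e * (d + g) = 0" "f * (d + g) = 0" "f * e + g * g = 1"
      "b * e = 0" "f * c = 0"
    and braid: "a * a + b * a * c = a" "g = f * g * e + g * g"
      "c * b + d * a * d + d * b * f + e * c * d + e * d * f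
        = a * d * a + a * e * c + b * f * a + b * g * c"
  shows "(a = 1 \<and> b = 0 \<and> c = 0 \<and> d = 0 \<and> e * f = 1 \<and> g = 0) \<or>
    (a = 0 \<and> b * c = 1 \<and> d = 0 \<and> e = 0 \<and> f = 0 \<and> g = 1) \<or>
    (a = 1 \<and> b = 0 \<and> c * e = 1 \<and> d = -1 \<and> f = 0 \<and> g = 1) \<or>
    (a = 1 \<and> b * f = 1 \<and> c = 0 \<and> d = -1 \<and> e = 0 \<and> g = 1) \<or>
    (a = 1 \<and> b = 0 \<and> c = 0 \<and> d = 1 \<and> e = 0 \<and> f = 0 \<and> g = 1)"
proof -
  \<comment> \<open>Substituting \<open>b * c = 1 - a * a\<close> into the braid equation leaves
    \<open>a * a = a * a * a\<close>; the same happens for \<open>g\<close>.\<close>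
  have "a * a * (a - 1) = 0" using inv(1) braid(1) by Groebner_Basis.algebra
  then have a: "a = 0 \<or> a = 1" by auto
  have "g * g * (g - 1) = 0" using inv(7) braid(2) by Groebner_Basis.algebra
  then have g: "g = 0 \<or> g = 1" by auto
  consider "a = 0" | "g = 0" "a = 1" | "a = 1" "g = 1" using a g by blast
  then show ?thesis
  proof cases
    case 1
    then have "b * c = 1" using inv by simp
    then have "b \<noteq> 0" "c \<noteq> 0" by auto
    then have "d = 0" "e = 0" "f = 0" using inv 1 by auto
    moreover from this have "g = 1" using inv(7) g by auto
    ultimately show ?thesis using 1 \<open>b * c = 1\<close> by blast
  next
    case 2
    then have "e * f = 1" using inv(7) by (simp add: mult.commute)
    then have "e \<noteq> 0" "f \<noteq> 0" by auto
    then show ?thesis using inv 2 \<open>e * f = 1\<close> by auto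
  next
    case 3
    have bc: "b * c = 0" and ef: "e * f = 0" using inv(1,7) 3 by (simp_all add: mult.commute)
    then have "(d - 1) * (d + 1) = 0" using inv(4) by Groebner_Basis.algebra
    then consider "d = 1" | "d = -1" by (auto simp: eq_neg_iff_add_eq_0)
    then show ?thesis
    proof cases
      case 1
      \<comment> \<open>Both \<open>a + d\<close> and \<open>d + g\<close> equal 2, so every
        off-diagonal entry vanishes.\<close>
      then show ?thesis using inv 3 by auto
    next
      case 2
      \<comment> \<open>The (1,1) braid equation is twice this one. It excludes diag(1,-1,1), and
        the vanishing products \<open>b * e\<close> and \<open>f * c\<close> let only one summand
        survive.\<close>
      have *: "c * e + b * f = 1" using braid(3) bc ef 2 3 by Groebner_Basis.algebra
      show ?thesis
      proof (cases "b = 0")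
        case True
        then show ?thesis using * inv(9) 2 3 by auto
      next
        case False
        then show ?thesis using * bc inv(8) 2 3 by auto
      qed
    qed
  qed
qed

text \<open>Both numbers are roots of t^2 - 2t + 1 = (t - 1)^2. This splits one equation mixing
  entries of \<open>M\<close> and \<open>N\<close> into two separate equalities.\<close>

lemma mult_eq_1_sum_eq_2:
  fixes x y :: complex
  assumes "x * y = 1" "x + y = 2"
  shows "x = 1 \<and> y = 1"
proof -
  have "(x - 1)\<^sup>2 = 0" using assms by Groebner_Basis.algebra
  then show ?thesis using assms by simp
qed

lemma mult_eq_1_reciprocal:
  fixes x y :: complex
  assumes "x * y = 1"
  shows "x \<noteq> 0 \<and> y \<noteq> 0 \<and> x = 1 / y \<and> y = 1 / x"
proof -
  have "x \<noteq> 0" "y \<noteq> 0" using assms by auto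
  then show ?thesis using assms by (simp add: field_simps)
qed

section \<open>Classification of the pairs of blocks\<close>

lemma hom_3local_WT_rep_in_five_families:
  assumes n: "n \<ge> 4" and rep: "hom_3local_WT_rep n M N"
  shows "(M, N) \<in> five_families"
proof -
  let ?S = "\<lambda>i. loc_mat n i M" and ?R = "\<lambda>i. loc_mat n i N"
  have dim: "M \<in> carrier_mat 3 3" "N \<in> carrier_mat 3 3"
    and VT: "VT_rep n ?S ?R"
    and weld: "\<forall>i\<in>{1..n-2}. ?R i * ?S (i+1) * ?S i = ?S (i+1) * ?S i * ?R (i+1)"
    using rep by (auto simp: hom_3local_WT_rep_def WT_rep_def)
  have i: "1 \<in> {1..n-1}" "3 \<in> {1..n-1}" "1 \<in> {1..n-2}" "1 + 2 \<le> (3::nat)" using n by auto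
  note VT = VT[unfolded VT_rep_def]
  have SS: "?S 1 * ?S 1 = 1\<^sub>m (n+1)" and RR: "?R 1 * ?R 1 = 1\<^sub>m (n+1)"
    and S13: "?S 1 * ?S 3 = ?S 3 * ?S 1" and R13: "?R 1 * ?R 3 = ?R 3 * ?R 1"
    and SR13: "?S 1 * ?R 3 = ?R 3 * ?S 1" and SR31: "?S 3 * ?R 1 = ?R 1 * ?S 3"
    and RRR: "?R 1 * ?R (1+1) * ?R 1 = ?R (1+1) * ?R 1 * ?R (1+1)"
    and RRS: "?R 1 * ?R (1+1) * ?S 1 = ?S (1+1) * ?R 1 * ?R (1+1)"
    using VT i by blast+
  note RS13 = SR31[symmetric]
  have RSS: "?R 1 * ?S (1+1) * ?S 1 = ?S (1+1) * ?S 1 * ?R (1+1)"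
    using weld i(3) by blast
  have triM: "tridiagonal3 M" and triN: "tridiagonal3 N"
    using loc_mat_commute_entries(1,2)[OF n S13] loc_mat_commute_entries(1,2)[OF n R13]
    by (auto simp: tridiagonal3_def)
  have n2: "n \<ge> 2" and n3: "n \<ge> 3" using n by auto
  note invM = loc_mat_involution_entries[OF n2 SS triM]
  note invN = loc_mat_involution_entries[OF n2 RR triN]
  note MN = loc_mat_commute_entries[OF n SR13]
  note NM = loc_mat_commute_entries[OF n RS13]
  \<comment> \<open>The braid, mixed and welded relations share the index pattern 1,2,1 = 2,1,2 and
    differ only in which factors are \<open>M\<close> and which are \<open>N\<close>.\<close>
  note braidN = loc_mat_braid_entries
    [OF n3 RRR[unfolded one_add_one] triN triN triN triN triN triN]
  note mixed = loc_mat_braid_entries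
    [OF n3 RRS[unfolded one_add_one] triN triN triM triM triN triN]
  note welded = loc_mat_braid_entries
    [OF n3 RSS[unfolded one_add_one] triN triM triM triM triM triN]
  note tri = triM[unfolded tridiagonal3_def] triN[unfolded tridiagonal3_def]
  note defs = M1_def N1_def M2_def N2_def M3_def M4_def mat_of_rows_list_def numeral_eq_Suc
  consider
    (1) "N $$ (0,0) = 1" "N $$ (0,1) = 0" "N $$ (1,0) = 0" "N $$ (1,1) = 0"
      "N $$ (1,2) * N $$ (2,1) = 1" "N $$ (2,2) = 0"
  | (2) "N $$ (0,0) = 0" "N $$ (0,1) * N $$ (1,0) = 1" "N $$ (1,1) = 0" "N $$ (1,2) = 0"
      "N $$ (2,1) = 0" "N $$ (2,2) = 1"
  | (3) "N $$ (0,0) = 1" "N $$ (0,1) = 0" "N $$ (1,0) * N $$ (1,2) = 1" "N $$ (1,1) = -1"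
      "N $$ (2,1) = 0" "N $$ (2,2) = 1"
  | (4) "N $$ (0,0) = 1" "N $$ (0,1) * N $$ (2,1) = 1" "N $$ (1,0) = 0" "N $$ (1,1) = -1"
      "N $$ (1,2) = 0" "N $$ (2,2) = 1"
  | (5) "N $$ (0,0) = 1" "N $$ (0,1) = 0" "N $$ (1,0) = 0" "N $$ (1,1) = 1" "N $$ (1,2) = 0"
      "N $$ (2,1) = 0" "N $$ (2,2) = 1"
    using involution_braid_cases[OF invN braidN(1,9,4)] by blast
  then show ?thesis
  proof cases
    case 1
    then have nz: "N $$ (1,2) \<noteq> 0" "N $$ (2,1) \<noteq> 0" by auto
    have M0: "M $$ (0,0) = 1" "M $$ (0,1) = 0" "M $$ (1,0) = 0" using NM nz by auto
    have "M $$ (1,1) * M $$ (2,2) = 0" using welded(8) 1 M0 nz by simp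
    \<comment> \<open>If either entry vanishes, \<open>M $$ (1,2) * M $$ (2,1) = 1\<close>, and then
      the sum of the two diagonal entries is zero.\<close>
    then have M2: "M $$ (2,2) = 0" "M $$ (1,1) = 0" using invM M0 by auto
    have M12: "M $$ (1,2) * M $$ (2,1) = 1" using invM M0 M2 by simp
    define h p where "h = M $$ (2,1)" and "p = N $$ (1,2)"
    have hp: "h \<noteq> 0" "p \<noteq> 0" "M $$ (1,2) = 1/h" "N $$ (2,1) = 1/p"
      using M12 1 by (auto simp: h_def p_def dest: mult_eq_1_reciprocal)
    have "M = M1 h" using dim M0 M2 tri hp(3) h_def
      by (intro mat3_eqI) (simp_all add: defs)
    moreover have "N = N1 p" using dim 1 tri hp(4) p_def
      by (intro mat3_eqI) (simp_all add: defs)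
    ultimately show ?thesis using hp by (auto simp: five_families_def)
  next
    \<comment> \<open>Reflection in the anti-diagonal reverses products and swaps the indices 1 and
      2, which preserves the mixed and welded relations. It carries case 1 to this case and case 3
      to case 4.\<close>
    case 2
    then have nz: "N $$ (0,1) \<noteq> 0" "N $$ (1,0) \<noteq> 0" by auto
    have M2: "M $$ (1,2) = 0" "M $$ (2,1) = 0" "M $$ (2,2) = 1" using MN nz by auto
    have "M $$ (0,0) * M $$ (1,1) = 0" using welded(2) 2 M2 nz by simp
    then have M0: "M $$ (0,0) = 0" "M $$ (1,1) = 0" using invM M2 by auto
    have M01: "M $$ (0,1) * M $$ (1,0) = 1" using invM M0 M2 by simp
    define d k where "d = M $$ (1,0)" and "k = N $$ (0,1)"
    have dk: "d \<noteq> 0" "k \<noteq> 0" "M $$ (0,1) = 1/d" "N $$ (1,0) = 1/k"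
      using M01 2 by (auto simp: d_def k_def dest: mult_eq_1_reciprocal)
    have "M = M2 d" using dim M0 M2 tri dk(3) d_def
      by (intro mat3_eqI) (simp_all add: defs)
    moreover have "N = N2 k" using dim 2 tri dk(4) k_def
      by (intro mat3_eqI) (simp_all add: defs)
    ultimately show ?thesis using dk by (auto simp: five_families_def)
  next
    case 3
    then have nz: "N $$ (1,0) \<noteq> 0" "N $$ (1,2) \<noteq> 0" by auto
    have M0: "M $$ (0,0) = 1" "M $$ (0,1) = 0" "M $$ (2,1) = 0" "M $$ (2,2) = 1"
      using MN NM nz by auto
    have "M $$ (1,0) * M $$ (1,2) + M $$ (1,1) = 0"
      using welded(8) 3 M0 nz by Groebner_Basis.algebra
    \<comment> \<open>Multiplying \<open>M $$ (1,0) * (1 + M $$ (1,1)) = 0\<close> by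
      \<open>M $$ (1,2)\<close> shows that \<open>M $$ (1,1)\<close> plus its square is zero, while
      its square is 1.\<close>
    moreover from this have M11: "M $$ (1,1) = -1"
      using invM(3,4) M0 by Groebner_Basis.algebra
    ultimately have "(N $$ (1,0) * M $$ (1,2)) * (M $$ (1,0) * N $$ (1,2)) = 1"
      "N $$ (1,0) * M $$ (1,2) + M $$ (1,0) * N $$ (1,2) = 2"
      using mixed(7) 3 M0 by Groebner_Basis.algebra+
    \<comment> \<open>Both cross products equal 1, as does \<open>N $$ (1,0) * N $$ (1,2)\<close>;
      cancelling identifies the entries.\<close>
    from mult_eq_1_sum_eq_2[OF this] have M1: "M $$ (1,2) = N $$ (1,2)" "M $$ (1,0) = N $$ (1,0)"
      using 3 by Groebner_Basis.algebra+
    define p where "p = N $$ (1,2)"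
    have p: "p \<noteq> 0" "N $$ (1,0) = 1/p" using 3 by (auto simp: p_def dest: mult_eq_1_reciprocal)
    have "M = M3 p" using dim M0 M11 M1 tri p(2) p_def
      by (intro mat3_eqI) (simp_all add: defs)
    moreover have "N = M3 p" using dim 3 tri p(2) p_def
      by (intro mat3_eqI) (simp_all add: defs)
    ultimately show ?thesis using p by (auto simp: five_families_def)
  next
    case 4
    then have nz: "N $$ (0,1) \<noteq> 0" "N $$ (2,1) \<noteq> 0" by auto
    have M0: "M $$ (0,0) = 1" "M $$ (1,0) = 0" "M $$ (1,2) = 0" "M $$ (2,2) = 1"
      using MN NM nz by auto
    have "M $$ (0,1) * M $$ (2,1) + M $$ (1,1) = 0"
      using welded(2) 4 M0 nz by Groebner_Basis.algebra
    moreover from this have M11: "M $$ (1,1) = -1"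
      using invM(2,4) M0 by Groebner_Basis.algebra
    ultimately have "(N $$ (0,1) * M $$ (2,1)) * (M $$ (0,1) * N $$ (2,1)) = 1"
      "N $$ (0,1) * M $$ (2,1) + M $$ (0,1) * N $$ (2,1) = 2"
      using mixed(4) 4 M0 by Groebner_Basis.algebra+
    from mult_eq_1_sum_eq_2[OF this] have M1: "M $$ (2,1) = N $$ (2,1)" "M $$ (0,1) = N $$ (0,1)"
      using 4 by Groebner_Basis.algebra+
    define k where "k = N $$ (0,1)"
    have k: "k \<noteq> 0" "N $$ (2,1) = 1/k" using 4 by (auto simp: k_def dest: mult_eq_1_reciprocal)
    have "M = M4 k" using dim M0 M11 M1 tri k(2) k_def
      by (intro mat3_eqI) (simp_all add: defs)
    moreover have "N = M4 k" using dim 4 tri k(2) k_def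
      by (intro mat3_eqI) (simp_all add: defs)
    ultimately show ?thesis using k by (auto simp: five_families_def)
  next
    case 5
    have "N = 1\<^sub>m 3" using dim 5 tri by (intro mat3_eqI) simp_all
    \<comment> \<open>For \<open>N\<close> the identity, the mixed relation equates the local
      matrices of \<open>M\<close> at indices 1 and 2. Row and column 0 of \<open>M\<close> are thus
      those of the identity, and the shift by one carries this down the diagonals.\<close>
    moreover have "M = 1\<^sub>m 3" using dim 5 tri mixed by (intro mat3_eqI) simp_all
    ultimately show ?thesis by (simp add: five_families_def)
  qed
qed

section \<open>Equivalence through the identity matrix\<close>

lemma equiv_rep_refl:
  assumes "\<forall>i\<in>{1..n-1}. S i \<in> carrier_mat (n+1) (n+1) \<and> R i \<in> carrier_mat (n+1) (n+1)"
  shows "equiv_rep n S R S R"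
  unfolding equiv_rep_def
proof (intro bexI conjI)
  show "invertible_mat (1\<^sub>m (n+1) :: complex mat)"
    by (auto simp: invertible_mat_def inverts_mat_def intro!: exI[of _ "1\<^sub>m (n+1)"])
qed (use assms in auto)

theorem theorem4p2:
  fixes n :: nat and M N :: "complex mat"
  assumes "n \<ge> 4"
    and "hom_3local_WT_rep n M N"
  shows "\<exists>(Mj, Nj) \<in> five_families.
           equiv_rep n (\<lambda>i. loc_mat n i M) (\<lambda>i. loc_mat n i N)
                       (\<lambda>i. loc_mat n i Mj) (\<lambda>i. loc_mat n i Nj)"
proof (rule bexI)
  show "(M, N) \<in> five_families"
    using assms by (rule hom_3local_WT_rep_in_five_families)
  show "case (M, N) of (Mj, Nj) \<Rightarrow>
      equiv_rep n (\<lambda>i. loc_mat n i M) (\<lambda>i. loc_mat n i N)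
                  (\<lambda>i. loc_mat n i Mj) (\<lambda>i. loc_mat n i Nj)"
    by (simp add: equiv_rep_refl)
qed

end
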